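(* Let $\eta_0,\nu_0,\tau_0\ge 0$ be real constants, and consider the algorithm $(\mathcal A)$ (defined in the context) with constant parameters $\eta=\eta_0$, $\nu=\nu_0$, $\tau=\tau_0$ (not depending on $q=\mu s$). (i) Suppose that one of the following conditions holds: (ia) $\nu_0,\tau_0>0$, $\nu_0\neq\tau_0$, and $0\le \eta_0<\nu_0\tau_0/2$; (ib) $\nu_0=\tau_0>2$ and $\eta_0=\tau_0^2/2$. Then there exist constants $C,C_0,C_1>0$, depending only on $(\eta_0,\nu_0,\tau_0)$, such that for all $0<\mu\le L$, all $f\in\mathcal S^1_{\mu,L}$, all $x_0\in\mathbb R^n$, all $0<s\le C_0\,\mu/L^2$ and all $k\ge 1$, the iterates of $(\mathcal A)$ satisfy $$f(x_k)-f^*\le C\,L\,\|x_0-x^*\|^2\,(1-C_1\sqrt{\mu s})^k .\qquad (1)$$ (ii) Suppose that one of the following conditions holds: (iia) $\nu_0,\tau_0>0$, $\nu_0\neq\tau_0$, and $\eta_0\ge \nu_0\tau_0/2$; (iib) $\nu_0=\tau_0\ge 2$ and $\eta_0>\tau_0^2/2$; (iic) $1<\nu_0=\tau_0<2$ and $\eta_0>\tau_0$; (iid) $0<\nu_0=\tau_0\le 1$ and $\eta_0\ge\tau_0$. Then there exist constants $C,C_0,C_1>0$, depending only on $(\eta_0,\nu_0,\tau_0)$, such that for all $0<\mu\le L$, all $f\in\mathcal S^1_{\mu,L}$, all $x_0\in\mathbb R^n$, all $0<s\le C_0/L$ and all $k\ge1$, the iterates of $(\mathcal A)$ satisfy (1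).
   Context: For $0<\mu\le L$, $\mathcal S^1_{\mu,L}$ is the set of continuously differentiable convex functions $f:\mathbb R^n\to\mathbb R$ that are $L$-smooth ($\|\nabla f(y)-\nabla f(x)\|\le L\|y-x\|$ for all $x,y$) and $\mu$-strongly convex ($f(y)\ge f(x)+\langle\nabla f(x),y-x\rangle+\frac{\mu}{2}\|y-x\|^2$ for all $x,y$); $\|\cdot\|$ is the Euclidean norm. $x^*$ is the unique minimizer of $f$ and $f^*=f(x^* )$. For a stepsize $s>0$ put $q=\mu s$. Algorithm $(\mathcal A)$ with parameters $\eta,\nu,\tau\ge0$: starting from $x_0=z_0\in\mathbb R^n$, for $k\ge0$, $$y_{k+1}=x_k-\eta s\nabla f(x_k),$$ $$z_{k+1}=\nu\sqrt q\,\Big(x_k-\frac1\mu\nabla f(x_k)\Big)+(1-\nu\sqrt q)z_k,$$ $$x_{k+1}=\frac{\tau\sqrt q}{1+\sqrt q}z_{k+1}+\Big(1-\frac{\tau\sqrt q}{1+\sqrt q}\Big)y_{k+1}.$$ *)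

theory Defs
  imports "HOL-Analysis.Analysis"
begin

text \<open>
  The constants in the theorem must not depend on the dimension, so the dimension has to be
  quantified inside the statement and cannot be a type. All the spaces \<open>\<real>\<^sup>n\<close> are therefore
  realised inside one inner product space, that of finitely supported real sequences, as the
  subspace \<open>Rn n\<close> of the sequences supported on \<open>{..<n}\<close>.
\<close>

typedef fseq = "{x :: nat \<Rightarrow> real. finite {i. x i \<noteq> 0}}"
  morphisms coord Abs_fseq
  by (rule exI[of _ "\<lambda>_. 0"]) simp

lemma finite_support: "finite {i. coord x i \<noteq> 0}"
  using coord[of x] by simp

lemma fseq_eqI: "(\<And>i. coord x i = coord y i) \<Longrightarrow> x = y"
  by (metis coord_inject ext)

lemma coord_Abs: "finite {i. g i \<noteq> 0} \<Longrightarrow> coord (Abs_fseq g) = g"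
  by (simp add: Abs_fseq_inverse)

instantiation fseq :: real_vector
begin

definition zero_fseq :: fseq where "0 = Abs_fseq (\<lambda>_. 0)"
definition plus_fseq :: "fseq \<Rightarrow> fseq \<Rightarrow> fseq" where "x + y = Abs_fseq (\<lambda>i. coord x i + coord y i)"
definition minus_fseq :: "fseq \<Rightarrow> fseq \<Rightarrow> fseq" where "x - y = Abs_fseq (\<lambda>i. coord x i - coord y i)"
definition uminus_fseq :: "fseq \<Rightarrow> fseq" where "- x = Abs_fseq (\<lambda>i. - coord x i)"
definition scaleR_fseq :: "real \<Rightarrow> fseq \<Rightarrow> fseq" where "c *\<^sub>R x = Abs_fseq (\<lambda>i. c * coord x i)"

lemma coord_zero [simp]: "coord 0 i = 0"
  by (simp add: zero_fseq_def coord_Abs)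

lemma coord_plus [simp]: "coord (x + y) i = coord x i + coord y i"
proof -
  have "finite {i. coord x i + coord y i \<noteq> 0}"
    by (rule finite_subset[of _ "{i. coord x i \<noteq> 0} \<union> {i. coord y i \<noteq> 0}"])
       (auto simp: finite_support)
  then show ?thesis by (simp add: plus_fseq_def coord_Abs)
qed

lemma coord_minus [simp]: "coord (x - y) i = coord x i - coord y i"
proof -
  have "finite {i. coord x i - coord y i \<noteq> 0}"
    by (rule finite_subset[of _ "{i. coord x i \<noteq> 0} \<union> {i. coord y i \<noteq> 0}"])
       (auto simp: finite_support)
  then show ?thesis by (simp add: minus_fseq_def coord_Abs)
qed

lemma coord_uminus [simp]: "coord (- x) i = - coord x i"
  by (simp add: uminus_fseq_def coord_Abs finite_support)

lemma coord_scaleR [simp]: "coord (c *\<^sub>R x) i = c * coord x i"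
proof -
  have "finite {i. c * coord x i \<noteq> 0}"
    by (rule finite_subset[of _ "{i. coord x i \<noteq> 0}"]) (auto simp: finite_support)
  then show ?thesis by (simp add: scaleR_fseq_def coord_Abs)
qed

instance
  by standard (auto intro!: fseq_eqI simp: algebra_simps)

end

instantiation fseq :: real_inner
begin

definition inner_fseq :: "fseq \<Rightarrow> fseq \<Rightarrow> real"
  where "inner x y = (\<Sum>i | coord x i \<noteq> 0. coord x i * coord y i)"
definition norm_fseq :: "fseq \<Rightarrow> real"
  where "norm x = sqrt (inner x x)" for x :: fseq
definition dist_fseq :: "fseq \<Rightarrow> fseq \<Rightarrow> real"
  where "dist x y = norm (x - y)" for x y :: fseq
definition sgn_fseq :: "fseq \<Rightarrow> fseq"
  where "sgn x = x /\<^sub>R norm x" for x :: fseq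
definition uniformity_fseq :: "(fseq \<times> fseq) filter"
  where "uniformity = (INF e\<in>{0 <..}. principal {(x :: fseq, y). dist x y < e})"
definition open_fseq :: "fseq set \<Rightarrow> bool"
  where "open U \<longleftrightarrow> (\<forall>x\<in>U. \<forall>\<^sub>F (x', y) in uniformity. x' = x \<longrightarrow> y \<in> U)" for U :: "fseq set"

lemma inner_fseq_superset:
  assumes "finite A" "{i. coord x i \<noteq> 0} \<subseteq> A"
  shows "inner x y = (\<Sum>i\<in>A. coord x i * coord y i)"
  unfolding inner_fseq_def by (rule sum.mono_neutral_left) (use assms in auto)

instance
proof
  fix x y z :: fseq and r :: real
  let ?A = "{i. coord x i \<noteq> 0} \<union> {i. coord y i \<noteq> 0}"
  have A: "finite ?A" by (simp add: finite_support)
  show "dist x y = norm (x - y)" by (rule dist_fseq_def)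
  show "sgn x = x /\<^sub>R norm x" by (rule sgn_fseq_def)
  show "uniformity = (INF e\<in>{0 <..}. principal {(x :: fseq, y). dist x y < e})"
    by (rule uniformity_fseq_def)
  show "open U \<longleftrightarrow> (\<forall>x\<in>U. \<forall>\<^sub>F (x', y) in uniformity. x' = x \<longrightarrow> y \<in> U)" for U :: "fseq set"
    by (rule open_fseq_def)
  have "inner x y = (\<Sum>i\<in>?A. coord x i * coord y i)"
    by (rule inner_fseq_superset[OF A]) auto
  moreover have "inner y x = (\<Sum>i\<in>?A. coord y i * coord x i)"
    by (rule inner_fseq_superset[OF A]) auto
  ultimately show "inner x y = inner y x" by (simp add: mult.commute)
  have "inner (x + y) z = (\<Sum>i\<in>?A. coord (x + y) i * coord z i)"
    by (rule inner_fseq_superset[OF A]) auto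
  moreover have "inner x z = (\<Sum>i\<in>?A. coord x i * coord z i)"
    by (rule inner_fseq_superset[OF A]) auto
  moreover have "inner y z = (\<Sum>i\<in>?A. coord y i * coord z i)"
    by (rule inner_fseq_superset[OF A]) auto
  ultimately show "inner (x + y) z = inner x z + inner y z"
    by (simp add: sum.distrib algebra_simps)
  have "inner (r *\<^sub>R x) y = (\<Sum>i\<in>{i. coord x i \<noteq> 0}. coord (r *\<^sub>R x) i * coord y i)"
    by (rule inner_fseq_superset) (auto simp: finite_support)
  then show "inner (r *\<^sub>R x) y = r * inner x y"
    by (simp add: inner_fseq_def sum_distrib_left algebra_simps)
  show "0 \<le> inner x x" by (simp add: inner_fseq_def sum_nonneg)
  show "inner x x = 0 \<longleftrightarrow> x = 0"
  proof
    assume "inner x x = 0"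
    then have "\<forall>i\<in>{i. coord x i \<noteq> 0}. coord x i * coord x i = 0"
      unfolding inner_fseq_def by (subst (asm) sum_nonneg_eq_0_iff) (auto simp: finite_support)
    then show "x = 0" by (intro fseq_eqI) auto
  qed (simp add: inner_fseq_def)
  show "norm x = sqrt (inner x x)" by (rule norm_fseq_def)
qed

end

definition Rn :: "nat \<Rightarrow> fseq set" where
  "Rn n = {x. \<forall>i\<ge>n. coord x i = 0}"

lemma subspace_Rn: "subspace (Rn n)"
  by (auto simp: subspace_def Rn_def)

lemma bij_betw_Rn: "bij_betw (\<lambda>x. restrict (coord x) {..<n}) (Rn n) ({..<n} \<rightarrow>\<^sub>E UNIV)"
proof (rule bij_betwI')
  fix x y assume xy: "x \<in> Rn n" "y \<in> Rn n"
  show "restrict (coord x) {..<n} = restrict (coord y) {..<n} \<longleftrightarrow> x = y"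
  proof
    assume r: "restrict (coord x) {..<n} = restrict (coord y) {..<n}"
    show "x = y"
    proof (rule fseq_eqI)
      fix i show "coord x i = coord y i"
        using xy fun_cong[OF r, of i] by (cases "i < n") (auto simp: Rn_def)
    qed
  qed simp
next
  fix a :: "nat \<Rightarrow> real" assume a: "a \<in> {..<n} \<rightarrow>\<^sub>E UNIV"
  let ?b = "\<lambda>i. if i < n then a i else 0"
  have "finite {i. ?b i \<noteq> 0}" by (rule finite_subset[of _ "{..<n}"]) auto
  then have c: "coord (Abs_fseq ?b) = ?b" by (rule coord_Abs)
  show "\<exists>x\<in>Rn n. a = restrict (coord x) {..<n}"
    by (rule bexI[of _ "Abs_fseq ?b"])
       (use a in \<open>auto simp: c Rn_def restrict_def PiE_def extensional_def fun_eq_iff\<close>)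
qed auto

lemma inner_Rn: "x \<in> Rn n \<Longrightarrow> inner x y = (\<Sum>i<n. coord x i * coord y i)"
  by (rule inner_fseq_superset) (auto simp: Rn_def not_less[symmetric])

lemma norm_Rn: "x \<in> Rn n \<Longrightarrow> norm x = L2_set (coord x) {..<n}"
  by (simp add: norm_fseq_def inner_Rn L2_set_def power2_eq_square)

text \<open>Derivatives are taken within \<open>Rn n\<close>, so values of \<open>f\<close> outside \<open>Rn n\<close> are irrelevant.\<close>

definition has_grad :: "nat \<Rightarrow> (fseq \<Rightarrow> real) \<Rightarrow> fseq \<Rightarrow> fseq \<Rightarrow> bool" where
  "has_grad n f x v \<longleftrightarrow> v \<in> Rn n \<and> (f has_derivative (\<lambda>h. inner v h)) (at x within Rn n)"

definition grad :: "nat \<Rightarrow> (fseq \<Rightarrow> real) \<Rightarrow> fseq \<Rightarrow> fseq" where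
  "grad n f x = (THE v. has_grad n f x v)"

lemma has_grad_unique:
  assumes x: "x \<in> Rn n" and v: "has_grad n f x v" and w: "has_grad n f x w"
  shows "v = w"
proof -
  define u where "u = v - w"
  have u: "u \<in> Rn n"
    using v w subspace_diff[OF subspace_Rn] by (auto simp: has_grad_def u_def)
  define \<gamma> where "\<gamma> = (\<lambda>t::real. x + t *\<^sub>R u)"
  have im: "\<gamma> ` UNIV \<subseteq> Rn n"
    using x u by (auto simp: \<gamma>_def intro!: subspace_add[OF subspace_Rn] subspace_scale[OF subspace_Rn])
  have \<gamma>: "(\<gamma> has_derivative (\<lambda>t. t *\<^sub>R u)) (at 0)"
    unfolding \<gamma>_def by (auto intro!: derivative_eq_intros)
  have d: "((\<lambda>t. f (\<gamma> t)) has_derivative (\<lambda>t. inner a (t *\<^sub>R u))) (at 0)" if "has_grad n f x a" for a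
  proof -
    have "(f has_derivative inner a) (at (\<gamma> 0) within \<gamma> ` UNIV)"
      using that im by (auto simp: has_grad_def \<gamma>_def intro: has_derivative_subset)
    from has_derivative_in_compose[OF \<gamma> this] show ?thesis by simp
  qed
  have "(\<lambda>t. inner v (t *\<^sub>R u)) = (\<lambda>t. inner w (t *\<^sub>R u))"
    by (rule has_derivative_unique[OF d[OF v] d[OF w]])
  from fun_cong[OF this, of 1] have "inner u u = 0"
    by (simp add: u_def inner_diff_left)
  then show ?thesis by (simp add: u_def)
qed

lemma grad_eq: "x \<in> Rn n \<Longrightarrow> has_grad n f x v \<Longrightarrow> grad n f x = v"
  unfolding grad_def by (blast intro: the_equality has_grad_unique)

definition S1 :: "nat \<Rightarrow> real \<Rightarrow> real \<Rightarrow> (fseq \<Rightarrow> real) set" where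
  "S1 n \<mu> L = {f.
     (\<forall>x\<in>Rn n. \<exists>v. has_grad n f x v) \<and>
     continuous_on (Rn n) (grad n f) \<and>
     convex_on (Rn n) f \<and>
     (\<forall>x\<in>Rn n. \<forall>y\<in>Rn n. norm (grad n f y - grad n f x) \<le> L * norm (y - x)) \<and>
     (\<forall>x\<in>Rn n. \<forall>y\<in>Rn n. f y \<ge> f x + inner (grad n f x) (y - x) + \<mu> / 2 * (norm (y - x))\<^sup>2)}"

definition algorithm_A ::
  "nat \<Rightarrow> (fseq \<Rightarrow> real) \<Rightarrow> real \<Rightarrow> real \<Rightarrow> real \<Rightarrow> real \<Rightarrow> real \<Rightarrow>
   (nat \<Rightarrow> fseq) \<Rightarrow> (nat \<Rightarrow> fseq) \<Rightarrow> (nat \<Rightarrow> fseq) \<Rightarrow> bool" where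
  "algorithm_A n f \<mu> s \<eta> \<nu> \<tau> x y z \<longleftrightarrow>
     (let q = \<mu> * s in
       x 0 \<in> Rn n \<and> z 0 = x 0 \<and>
       (\<forall>k. y (Suc k) = x k - (\<eta> * s) *\<^sub>R grad n f (x k)) \<and>
       (\<forall>k. z (Suc k) = (\<nu> * sqrt q) *\<^sub>R (x k - (1 / \<mu>) *\<^sub>R grad n f (x k))
                          + (1 - \<nu> * sqrt q) *\<^sub>R z k) \<and>
       (\<forall>k. x (Suc k) = (\<tau> * sqrt q / (1 + sqrt q)) *\<^sub>R z (Suc k)
                          + (1 - \<tau> * sqrt q / (1 + sqrt q)) *\<^sub>R y (Suc k)))"

end

theory Submission
  imports Defs
begin

text \<open>
  Put \<open>r = sqrt (\<mu> s)\<close>, let \<open>u\<close> be the error \<open>x - x\<^sup>*\<close> and \<open>g\<close> the gradient at \<open>x\<close>. Up to reparametrisation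
  the algorithm is \<open>x' = x + d - \<eta> s g\<close>, \<open>d' = (1 - \<alpha>) d - s b g'\<close> with \<open>\<alpha>\<close> of order \<open>r\<close> and
  \<open>b \<le> \<nu> \<tau>\<close>, a discretisation of a damped oscillator with velocity \<open>v\<close> whose energy
  \<open>2 b f(x) + |v|\<^sup>2/2 + |v + a x|\<^sup>2/2\<close> decays exponentially, because \<open>v + a x\<close> has derivative \<open>- b g\<close>.
  Discretisation adds \<open>2 s\<^sup>2 b (b - 2 \<eta>) |g'|\<^sup>2\<close> to the energy balance. This is harmless for
  \<open>\<eta> \<ge> \<nu> \<tau> / 2\<close>; otherwise \<open>|g|\<^sup>2 \<le> 4 L (f(x) - f\<^sup>*)\<close> lets the dissipation, of order
  \<open>r s (f(x) - f\<^sup>*)\<close>, absorb it as soon as \<open>s L\<close> is small compared with \<open>r\<close>, i.e. \<open>s \<le> C\<^sub>0 \<mu> / L\<^sup>2\<close>.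
  All other errors are of order \<open>r s\<^sup>2 |g|\<^sup>2\<close> and only need \<open>s L\<close> small.
\<close>

section \<open>Energy balance of a damped gradient step\<close>

text \<open>The damping of \<open>d\<close> cancels the drift of
  \<open>\<alpha> *\<^sub>R u\<close>, so \<open>d + \<alpha> *\<^sub>R u\<close> changes only by
  multiples of \<open>g\<close> and \<open>g'\<close>. Pairing \<open>g'\<close> with the new point
  \<open>u'\<close> makes the products of \<open>g\<close> with \<open>g'\<close> cancel.\<close>

lemma kinetic_energy_step:
  fixes u d g g' :: "'a::real_inner" and \<alpha> b s \<eta> :: real
  defines "u' \<equiv> u + d - (\<eta> * s) *\<^sub>R g" and "d' \<equiv> (1 - \<alpha>) *\<^sub>R d - (s * b) *\<^sub>R g'"
  shows "(norm d')\<^sup>2 + (norm (d' + \<alpha> *\<^sub>R u'))\<^sup>2 = (norm d)\<^sup>2 + (norm (d + \<alpha> *\<^sub>R u))\<^sup>2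
    - \<alpha> * (2 - \<alpha>) * (norm d)\<^sup>2 - 2 * s * b * \<alpha> * (u' \<bullet> g') - 4 * s * b * (1 - \<alpha>) * (d \<bullet> g')
    + 2 * s\<^sup>2 * b\<^sup>2 * (norm g')\<^sup>2 + \<alpha>\<^sup>2 * \<eta>\<^sup>2 * s\<^sup>2 * (norm g)\<^sup>2
    - 2 * \<alpha> * \<eta> * s * (d \<bullet> g) - 2 * \<alpha>\<^sup>2 * \<eta> * s * (u \<bullet> g)"
  unfolding u'_def d'_def power2_norm_eq_inner
  by (simp add: inner_add_left inner_add_right inner_diff_left inner_diff_right inner_commute
      power2_eq_square algebra_simps)

lemma young_inner:
  fixes a b :: "'a::real_inner"
  assumes "0 < c"
  shows "2 * (a \<bullet> b) \<le> c * (norm a)\<^sup>2 + (norm b)\<^sup>2 / c"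
proof -
  have "0 \<le> (norm (c *\<^sub>R a - b))\<^sup>2 / c" using assms by simp
  also have "(norm (c *\<^sub>R a - b))\<^sup>2 = c\<^sup>2 * (norm a)\<^sup>2 - 2 * c * (a \<bullet> b) + (norm b)\<^sup>2"
    unfolding power2_norm_eq_inner
    by (simp add: inner_diff_left inner_diff_right inner_commute power2_eq_square algebra_simps)
  finally show ?thesis using assms by (simp add: field_simps power2_eq_square)
qed

lemma norm_add_sq_le:
  fixes a b :: "'a::real_inner"
  shows "(norm (a + b))\<^sup>2 \<le> 2 * (norm a)\<^sup>2 + 2 * (norm b)\<^sup>2"
  using young_inner[of 1 a b] by (simp add: power2_norm_eq_inner inner_add_left inner_add_right inner_commute)

section \<open>Lyapunov function and its contraction\<close>

text \<open>The negative term makes the gradient contributions of two consecutive steps telescope.\<close>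

definition lyapunov :: "real \<Rightarrow> real \<Rightarrow> real \<Rightarrow> real \<Rightarrow> real \<Rightarrow> 'a \<Rightarrow> 'a \<Rightarrow> 'a::real_inner \<Rightarrow> real" where
  "lyapunov s b \<eta> \<alpha> F u d g =
     4 * s * b * F + (norm d)\<^sup>2 + (norm (d + \<alpha> *\<^sub>R u))\<^sup>2 - 2 * \<eta> * s\<^sup>2 * b * (norm g)\<^sup>2"

text \<open>Smallness of \<open>s * L\<close> keeps the subtracted gradient term below half of
  \<open>4 * s * b * F\<close>. This converts decay of the Lyapunov function into decay of
  \<open>F\<close>.\<close>

lemma lyapunov_ge:
  fixes u d g :: "'a::real_inner"
  assumes "0 < s" "0 < b" "0 \<le> \<eta>" "(norm g)\<^sup>2 \<le> 4 * L * F" "4 * \<eta> * (s * L) \<le> 1" "0 \<le> F"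
  shows "2 * s * b * F \<le> lyapunov s b \<eta> \<alpha> F u d g"
proof -
  have "2 * \<eta> * s\<^sup>2 * b * (norm g)\<^sup>2 \<le> 2 * \<eta> * s\<^sup>2 * b * (4 * L * F)"
    using assms by (intro mult_left_mono) auto
  also have "\<dots> = (4 * \<eta> * (s * L)) * (2 * s * b * F)" by (simp add: power2_eq_square)
  also have "\<dots> \<le> 1 * (2 * s * b * F)" using assms by (intro mult_right_mono) auto
  finally have "2 * \<eta> * s\<^sup>2 * b * (norm g)\<^sup>2 \<le> 2 * s * b * F" by simp
  then show ?thesis
    unfolding lyapunov_def using zero_le_power2[of "norm d"] zero_le_power2[of "norm (d + \<alpha> *\<^sub>R u)"]
    by linarith
qed

lemma lyapunov_le:
  fixes u d g :: "'a::real_inner"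
  assumes "0 < s" "0 < b" "0 \<le> \<eta>"
  shows "lyapunov s b \<eta> \<alpha> F u d g \<le> 4 * s * b * F + 3 * (norm d)\<^sup>2 + 2 * \<alpha>\<^sup>2 * (norm u)\<^sup>2"
proof -
  have "0 \<le> 2 * \<eta> * s\<^sup>2 * b * (norm g)\<^sup>2" using assms by simp
  with norm_add_sq_le[of d "\<alpha> *\<^sub>R u"] show ?thesis
    unfolding lyapunov_def norm_scaleR power_mult_distrib power2_abs by linarith
qed

text \<open>Adding \<open>4 * s * b\<close> times \<open>coco\<close> to the kinetic identity
  cancels the products \<open>d \<bullet> g'\<close> up to a factor \<open>\<alpha>\<close>. The
  available dissipation is \<alpha> |d|^2 + 2 \<alpha> s b F' + \<alpha> s b \<mu> |u'|^2; half of
  each of the first two terms pays for the errors, and the rest stays in the conclusion.\<close>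

lemma lyapunov_dissipation:
  fixes u d g g' :: "'a::real_inner" and \<alpha> b s \<eta> \<mu> L F F' :: real
  defines "u' \<equiv> u + d - (\<eta> * s) *\<^sub>R g" and "d' \<equiv> (1 - \<alpha>) *\<^sub>R d - (s * b) *\<^sub>R g'"
  assumes pos: "0 < s" "0 < b" "0 \<le> \<eta>" "0 < \<alpha>" "\<alpha> \<le> 1" "0 < L" "0 \<le> F'"
    and mono: "0 \<le> u \<bullet> g" and strong: "F' + \<mu> / 2 * (norm u')\<^sup>2 \<le> u' \<bullet> g'"
    and grad: "(norm g')\<^sup>2 \<le> 4 * L * F'"
    and coco: "F' \<le> F + g' \<bullet> (u' - u) - (norm (g' - g))\<^sup>2 / (4 * L)"
    and small: "4 * \<eta> * (s * L) \<le> 1" "20 * \<eta>\<^sup>2 * (s * L) \<le> b"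
      "8 * (16 * b\<^sup>2 + 10 * \<eta>\<^sup>2) * (s * L) \<le> b"
    and damp: "b \<le> 2 * \<eta> \<or> 16 * b * (s * L) \<le> \<alpha>"
  shows "lyapunov s b \<eta> \<alpha> F' u' d' g' + \<alpha> * (1 / 2 * (norm d)\<^sup>2 + s * b * F' + s * b * \<mu> * (norm u')\<^sup>2)
    \<le> lyapunov s b \<eta> \<alpha> F u d g"
proof -
  define G G' D N where "G = (norm g)\<^sup>2" and "G' = (norm g')\<^sup>2" and "D = (norm (g' - g))\<^sup>2"
    and "N = (norm d)\<^sup>2"
  have nn: "0 \<le> G" "0 \<le> G'" "0 \<le> D" "0 \<le> N" by (auto simp: G_def G'_def D_def N_def)
  \<comment> \<open>Polarization: the part in \<open>G\<close> will cancel the gradient term of the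
    old Lyapunov value, the part in \<open>G'\<close> doubles that of the new one, and
    \<open>D\<close> is left for \<open>y4\<close>.\<close>
  have gg: "2 * (g \<bullet> g') = G + G' - D"
    unfolding G_def G'_def D_def power2_norm_eq_inner
    by (simp add: inner_diff_left inner_diff_right inner_commute)
  have GD: "G \<le> 2 * G' + 2 * D"
    using norm_add_sq_le[of g' "g - g'"] by (simp add: G_def G'_def D_def norm_minus_commute)
  have coco': "4 * s * b * F' \<le> 4 * s * b * F + 4 * s * b * (d \<bullet> g') - 2 * \<eta> * s\<^sup>2 * b * (G + G' - D)
      - s * b * D / L"
  proof -
    have "4 * s * b * F' \<le> 4 * s * b * (F + g' \<bullet> (u' - u) - D / (4 * L))"
      using coco pos by (intro mult_left_mono) (auto simp: D_def)
    also have "g' \<bullet> (u' - u) = d \<bullet> g' - \<eta> * s * (g \<bullet> g')"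
      by (simp add: u'_def inner_diff_right inner_commute)
    also have "4 * s * b * (F + (d \<bullet> g' - \<eta> * s * (g \<bullet> g')) - D / (4 * L)) =
      4 * s * b * F + 4 * s * b * (d \<bullet> g') - 2 * \<eta> * s\<^sup>2 * b * (2 * (g \<bullet> g')) - s * b * D / L"
      using pos by (simp add: field_simps power2_eq_square)
    finally show ?thesis by (simp add: gg)
  qed
  have mono': "0 \<le> 2 * \<alpha>\<^sup>2 * \<eta> * s * (u \<bullet> g)" using pos mono by simp
  have strong': "2 * s * b * \<alpha> * (F' + \<mu> / 2 * (norm u')\<^sup>2) \<le> 2 * s * b * \<alpha> * (u' \<bullet> g')"
    using strong pos by (intro mult_left_mono) auto
  \<comment> \<open>This product is left over because the kinetic identity carries
    \<open>1 - \<alpha>\<close> where cocoercivity carries \<open>1\<close>. The scalings here and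
    in \<open>y2\<close> are chosen so that each bound spends a quarter of
    \<open>\<alpha> * N\<close>.\<close>
  have y1: "4 * s * b * \<alpha> * (d \<bullet> g') \<le> \<alpha> * (N / 4 + 16 * s\<^sup>2 * b\<^sup>2 * G')"
  proof -
    have "2 * (d \<bullet> ((8 * s * b) *\<^sub>R g')) \<le> 1 * N + (norm ((8 * s * b) *\<^sub>R g'))\<^sup>2 / 1"
      unfolding N_def by (rule young_inner) simp
    then have "4 * s * b * (d \<bullet> g') \<le> N / 4 + 16 * s\<^sup>2 * b\<^sup>2 * G'"
      by (simp add: G'_def power_mult_distrib)
    from mult_left_mono[OF this, of \<alpha>] show ?thesis using pos by (simp add: mult_ac)
  qed
  have y2: "- 2 * \<alpha> * \<eta> * s * (d \<bullet> g) \<le> \<alpha> * (N / 4 + 4 * s\<^sup>2 * \<eta>\<^sup>2 * G)"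
  proof -
    have "2 * (d \<bullet> ((- 4 * s * \<eta>) *\<^sub>R g)) \<le> 1 * N + (norm ((- 4 * s * \<eta>) *\<^sub>R g))\<^sup>2 / 1"
      unfolding N_def by (rule young_inner) simp
    then have "- 2 * \<eta> * s * (d \<bullet> g) \<le> N / 4 + 4 * s\<^sup>2 * \<eta>\<^sup>2 * G"
      by (simp add: G_def power_mult_distrib mult_ac)
    from mult_left_mono[OF this, of \<alpha>] show ?thesis using pos by (simp add: mult_ac)
  qed
  \<comment> \<open>The dissipation controls the gradient at the new point, so \<open>G\<close> is
    traded for \<open>G'\<close> and the difference \<open>D\<close>.\<close>
  have y3: "\<alpha>\<^sup>2 * \<eta>\<^sup>2 * s\<^sup>2 * G + 4 * \<alpha> * s\<^sup>2 * \<eta>\<^sup>2 * G \<le> \<alpha> * (10 * s\<^sup>2 * \<eta>\<^sup>2 * G') + 10 * s\<^sup>2 * \<eta>\<^sup>2 * D"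
  proof -
    have "\<alpha>\<^sup>2 * \<eta>\<^sup>2 * s\<^sup>2 * G + 4 * \<alpha> * s\<^sup>2 * \<eta>\<^sup>2 * G = \<alpha> * (\<alpha> + 4) * (s\<^sup>2 * \<eta>\<^sup>2) * G"
      by (simp add: algebra_simps power2_eq_square)
    also have "\<dots> \<le> \<alpha> * 5 * (s\<^sup>2 * \<eta>\<^sup>2) * (2 * G' + 2 * D)"
      using pos nn GD by (intro mult_mono) auto
    also have "\<dots> = \<alpha> * (10 * s\<^sup>2 * \<eta>\<^sup>2 * G') + \<alpha> * (10 * s\<^sup>2 * \<eta>\<^sup>2 * D)" by (simp add: algebra_simps)
    also have "\<alpha> * (10 * s\<^sup>2 * \<eta>\<^sup>2 * D) \<le> 1 * (10 * s\<^sup>2 * \<eta>\<^sup>2 * D)"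
      using pos nn by (intro mult_right_mono) auto
    finally show ?thesis by simp
  qed
  \<comment> \<open>The negative term of cocoercivity absorbs every multiple of \<open>D\<close>;
    the two summands take at most half of it each.\<close>
  have y4: "10 * s\<^sup>2 * \<eta>\<^sup>2 * D + 2 * \<eta> * s\<^sup>2 * b * D \<le> s * b * D / L"
  proof -
    have "(20 * \<eta>\<^sup>2 * (s * L) + 4 * \<eta> * (s * L) * b) * (s * D / (2 * L)) \<le> (b + 1 * b) * (s * D / (2 * L))"
      using pos nn small by (intro mult_right_mono add_mono) auto
    moreover have "(20 * \<eta>\<^sup>2 * (s * L) + 4 * \<eta> * (s * L) * b) * (s * D / (2 * L))
        = 10 * s\<^sup>2 * \<eta>\<^sup>2 * D + 2 * \<eta> * s\<^sup>2 * b * D"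
      using pos by (simp add: field_simps power2_eq_square)
    ultimately show ?thesis using pos by (simp add: mult_ac)
  qed
  have y5: "\<alpha> * (16 * s\<^sup>2 * b\<^sup>2 * G') + \<alpha> * (10 * s\<^sup>2 * \<eta>\<^sup>2 * G') \<le> \<alpha> * s * b * F' / 2"
  proof -
    have "\<alpha> * (16 * s\<^sup>2 * b\<^sup>2 * G') + \<alpha> * (10 * s\<^sup>2 * \<eta>\<^sup>2 * G') = \<alpha> * s\<^sup>2 * (16 * b\<^sup>2 + 10 * \<eta>\<^sup>2) * G'"
      by (simp add: algebra_simps)
    also have "\<dots> \<le> \<alpha> * s\<^sup>2 * (16 * b\<^sup>2 + 10 * \<eta>\<^sup>2) * (4 * L * F')"
      using pos grad by (intro mult_left_mono) (auto simp: G'_def)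
    also have "\<dots> = (8 * (16 * b\<^sup>2 + 10 * \<eta>\<^sup>2) * (s * L)) * (\<alpha> * s * F' / 2)"
      by (simp add: power2_eq_square)
    also have "\<dots> \<le> b * (\<alpha> * s * F' / 2)"
      using pos small by (intro mult_right_mono) auto
    finally show ?thesis by (simp add: mult_ac)
  qed
  \<comment> \<open>The critical term 2 s^2 b (b - 2 \<eta>) G' has no factor
    \<open>\<alpha>\<close>. It is nonpositive if \<open>b \<le> 2 * \<eta>\<close>; otherwise the
    second alternative of \<open>damp\<close> supplies the missing factor.\<close>
  have y6: "2 * s\<^sup>2 * b\<^sup>2 * G' - 4 * \<eta> * s\<^sup>2 * b * G' \<le> \<alpha> * s * b * F' / 2"
    using damp
  proof
    assume "b \<le> 2 * \<eta>"
    then have "2 * s\<^sup>2 * b * G' * b \<le> 2 * s\<^sup>2 * b * G' * (2 * \<eta>)"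
      using pos nn by (intro mult_left_mono) auto
    moreover have "0 \<le> \<alpha> * s * b * F' / 2" using pos by simp
    ultimately show ?thesis by (simp add: power2_eq_square mult_ac)
  next
    assume a: "16 * b * (s * L) \<le> \<alpha>"
    have "2 * s\<^sup>2 * b\<^sup>2 * G' \<le> 2 * s\<^sup>2 * b\<^sup>2 * (4 * L * F')"
      using pos grad by (intro mult_left_mono) (auto simp: G'_def)
    also have "\<dots> = 16 * b * (s * L) * (s * b * F' / 2)" by (simp add: power2_eq_square)
    also have "\<dots> \<le> \<alpha> * (s * b * F' / 2)" using pos a by (intro mult_right_mono) auto
    finally have "2 * s\<^sup>2 * b\<^sup>2 * G' \<le> \<alpha> * s * b * F' / 2" by simp
    moreover have "0 \<le> 4 * \<eta> * s\<^sup>2 * b * G'" using pos nn by simp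
    ultimately show ?thesis by linarith
  qed
  have y7: "\<alpha> * 1 * N \<le> \<alpha> * (2 - \<alpha>) * N"
    using pos nn by (intro mult_right_mono mult_left_mono) auto
  note id = kinetic_energy_step[of \<alpha> d s b g' u \<eta> g, folded u'_def d'_def, folded G_def G'_def N_def]
  show ?thesis
    unfolding lyapunov_def G_def[symmetric] G'_def[symmetric] N_def[symmetric]
    using id coco' mono' strong' y1 y2 y3 y4 y5 y6 y7 by (simp add: algebra_simps)
qed

text \<open>The dissipated energy \<open>?E\<close> dominates \<open>?V' / M\<close>, hence
  \<open>(1 + \<alpha> / M) * ?V' \<le> ?V\<close>. The comparison is with the new value since
  \<open>F'\<close> and \<open>u'\<close> in \<open>?E\<close> belong to the new point. For
  \<open>\<alpha>\<close> of order \<open>sqrt (\<mu> * s)\<close>, \<open>M\<close> can be a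
  constant.\<close>

lemma lyapunov_contraction:
  fixes u d g g' :: "'a::real_inner" and \<alpha> b s \<eta> \<mu> L F F' :: real
  defines "u' \<equiv> u + d - (\<eta> * s) *\<^sub>R g" and "d' \<equiv> (1 - \<alpha>) *\<^sub>R d - (s * b) *\<^sub>R g'"
  assumes pos: "0 < s" "0 < b" "0 \<le> \<eta>" "0 < \<alpha>" "\<alpha> \<le> 1" "0 < L" "0 \<le> F'" "0 < \<mu>"
    and mono: "0 \<le> u \<bullet> g" and strong: "F' + \<mu> / 2 * (norm u')\<^sup>2 \<le> u' \<bullet> g'"
    and grad: "(norm g')\<^sup>2 \<le> 4 * L * F'"
    and coco: "F' \<le> F + g' \<bullet> (u' - u) - (norm (g' - g))\<^sup>2 / (4 * L)"
    and small: "4 * \<eta> * (s * L) \<le> 1" "20 * \<eta>\<^sup>2 * (s * L) \<le> b"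
      "8 * (16 * b\<^sup>2 + 10 * \<eta>\<^sup>2) * (s * L) \<le> b" "8 * b * (s * L) \<le> 1"
    and damp: "b \<le> 2 * \<eta> \<or> 16 * b * (s * L) \<le> \<alpha>"
    and M: "12 \<le> M" "2 * \<alpha>\<^sup>2 \<le> M * (b * (\<mu> * s))"
  shows "lyapunov s b \<eta> \<alpha> F' u' d' g' \<le> (1 - \<alpha> / (2 * M)) * lyapunov s b \<eta> \<alpha> F u d g"
proof -
  let ?V = "lyapunov s b \<eta> \<alpha> F u d g" and ?V' = "lyapunov s b \<eta> \<alpha> F' u' d' g'"
  let ?E = "1 / 2 * (norm d)\<^sup>2 + s * b * F' + s * b * \<mu> * (norm u')\<^sup>2"
  have diss: "?V' + \<alpha> * ?E \<le> ?V"
    unfolding u'_def d'_def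
    by (rule lyapunov_dissipation) (use assms in \<open>simp_all add: u'_def\<close>)
  \<comment> \<open>The dissipation contains the old velocity but \<open>?V'\<close> the new one;
    the gradient part of \<open>d'\<close> is absorbed by \<open>F'\<close>.\<close>
  have "(norm d')\<^sup>2 \<le> 2 * (norm d)\<^sup>2 + s * b * F'"
  proof -
    have "(norm d')\<^sup>2 \<le> 2 * ((1 - \<alpha>)\<^sup>2 * (norm d)\<^sup>2) + 2 * ((s * b)\<^sup>2 * (norm g')\<^sup>2)"
      using norm_add_sq_le[of "(1 - \<alpha>) *\<^sub>R d" "- (s * b) *\<^sub>R g'"]
      by (simp add: d'_def power_mult_distrib)
    moreover have "(1 - \<alpha>)\<^sup>2 * (norm d)\<^sup>2 \<le> 1 * (norm d)\<^sup>2"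
      using pos by (intro mult_right_mono power_le_one) auto
    moreover have "2 * ((s * b)\<^sup>2 * (norm g')\<^sup>2) \<le> 2 * ((s * b)\<^sup>2 * (4 * L * F'))"
      using grad by (intro mult_left_mono) auto
    moreover have "2 * ((s * b)\<^sup>2 * (4 * L * F')) = 8 * b * (s * L) * (s * b * F')"
      by (simp add: power2_eq_square)
    moreover have "\<dots> \<le> 1 * (s * b * F')" using pos small by (intro mult_right_mono) auto
    ultimately show ?thesis by linarith
  qed
  moreover have "?V' \<le> 4 * s * b * F' + 3 * (norm d')\<^sup>2 + 2 * \<alpha>\<^sup>2 * (norm u')\<^sup>2"
    by (rule lyapunov_le) (use pos in auto)
  moreover have "2 * \<alpha>\<^sup>2 * (norm u')\<^sup>2 \<le> M * (b * (\<mu> * s)) * (norm u')\<^sup>2"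
    using M by (intro mult_right_mono) auto
  \<comment> \<open>The factor 12 covers 6 |d|^2 and the 4 + 3 copies of
    \<open>s * b * F'\<close>.\<close>
  moreover have "12 * (1 / 2 * (norm d)\<^sup>2 + s * b * F') \<le> M * (1 / 2 * (norm d)\<^sup>2 + s * b * F')"
    using M pos by (intro mult_right_mono) auto
  moreover have "0 \<le> s * b * F'" using pos by simp
  ultimately have "?V' \<le> M * ?E" by (simp add: algebra_simps)
  then have "\<alpha> / M * ?V' \<le> \<alpha> / M * (M * ?E)" using pos M by (intro mult_left_mono) auto
  then have "(1 + \<alpha> / M) * ?V' \<le> ?V" using diss M by (simp add: algebra_simps)
  moreover define p where "p = \<alpha> / M"
  ultimately have V: "(1 + p) * ?V' \<le> ?V" by simp
  have p: "0 < p" "p \<le> 1" using pos M by (auto simp: p_def divide_simps)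
  have "0 \<le> 2 * s * b * F'" using pos by simp
  also have "\<dots> \<le> ?V'" by (rule lyapunov_ge) (use assms in auto)
  finally have V0: "0 \<le> ?V'" .
  \<comment> \<open>For 0 < p \<le> 1 one has 1 / (1 + p) \<le> 1 - p / 2.\<close>
  have "1 * ?V' \<le> (1 - p / 2) * (1 + p) * ?V'"
  proof (rule mult_right_mono)
    have "p * p \<le> p * 1" using p by (intro mult_left_mono) auto
    then show "1 \<le> (1 - p / 2) * (1 + p)" by (simp add: algebra_simps)
  qed (rule V0)
  also have "\<dots> \<le> (1 - p / 2) * ?V"
    unfolding mult.assoc using p V by (intro mult_left_mono) auto
  finally show ?thesis by (simp add: p_def mult.commute)
qed

section \<open>Smooth convex functions on a subspace\<close>

text \<open>The point \<open>w\<close> is a gradient step of length \<open>1 / (2 * L)\<close> from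
  \<open>x\<close> for \<open>f\<close> minus its linearisation at \<open>y\<close>. Convexity at
  \<open>w\<close> bounds \<open>f w\<close> above with slope \<open>G w\<close>; the Lipschitz
  bound exchanges it for \<open>G x\<close> at half of the gain. Avoiding integration of the
  gradient along a segment gives the constant 1/(4L) instead of the sharp 1/(2L).\<close>

lemma convex_smooth_cocoercive:
  fixes f :: "'a::real_inner \<Rightarrow> real" and G :: "'a \<Rightarrow> 'a"
  assumes S: "subspace S" "\<And>x. x \<in> S \<Longrightarrow> G x \<in> S" and L: "0 < L"
    and lip: "\<And>x y. x \<in> S \<Longrightarrow> y \<in> S \<Longrightarrow> norm (G y - G x) \<le> L * norm (y - x)"
    and conv: "\<And>x y. x \<in> S \<Longrightarrow> y \<in> S \<Longrightarrow> f x + G x \<bullet> (y - x) \<le> f y"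
    and xy: "x \<in> S" "y \<in> S"
  shows "f y + G y \<bullet> (x - y) + (norm (G x - G y))\<^sup>2 / (4 * L) \<le> f x"
proof -
  define D w where "D = G x - G y" and "w = x - (1 / (2 * L)) *\<^sub>R D"
  have w: "w \<in> S"
    unfolding w_def D_def by (intro subspace_diff subspace_scale S xy)
  have "(G w - G x) \<bullet> (w - x) \<le> norm (G w - G x) * norm (w - x)" by (rule norm_cauchy_schwarz)
  also have "\<dots> \<le> L * norm (w - x) * norm (w - x)" using lip[OF xy(1) w] by (intro mult_right_mono) auto
  also have "\<dots> = (norm D)\<^sup>2 / (4 * L)" using L by (simp add: w_def power2_eq_square field_simps)
  finally have 1: "G w \<bullet> (w - x) \<le> G x \<bullet> (w - x) + (norm D)\<^sup>2 / (4 * L)"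
    by (simp add: inner_diff_left)
  have "f w \<le> f x + G w \<bullet> (w - x)"
    using conv[OF w xy(1)] by (simp add: inner_diff_right)
  moreover have "f y + G y \<bullet> (w - y) \<le> f w" using conv[OF xy(2) w] .
  moreover have "G y \<bullet> (w - y) = G y \<bullet> (x - y) + G y \<bullet> (w - x)" by (simp add: inner_diff_right)
  moreover have "G x \<bullet> (w - x) - G y \<bullet> (w - x) = - (D \<bullet> D) / (2 * L)"
    unfolding inner_diff_left[symmetric] D_def[symmetric] by (simp add: w_def)
  ultimately show ?thesis
    using 1 by (simp add: D_def power2_norm_eq_inner field_simps)
qed

lemma grad_in_Rn:
  assumes "f \<in> S1 n \<mu> L" "x \<in> Rn n"
  shows "grad n f x \<in> Rn n"
proof -
  obtain v where "has_grad n f x v" using assms by (auto simp: S1_def)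
  then show ?thesis using grad_eq[OF assms(2)] by (simp add: has_grad_def)
qed

lemma S1_lipschitz:
  "f \<in> S1 n \<mu> L \<Longrightarrow> x \<in> Rn n \<Longrightarrow> y \<in> Rn n \<Longrightarrow> norm (grad n f y - grad n f x) \<le> L * norm (y - x)"
  by (simp add: S1_def)

lemma S1_strongly_convex:
  "f \<in> S1 n \<mu> L \<Longrightarrow> x \<in> Rn n \<Longrightarrow> y \<in> Rn n \<Longrightarrow>
    f x + inner (grad n f x) (y - x) + \<mu> / 2 * (norm (y - x))\<^sup>2 \<le> f y"
  by (simp add: S1_def)

lemma S1_cocoercive:
  assumes "f \<in> S1 n \<mu> L" "0 < \<mu>" "0 < L" "x \<in> Rn n" "y \<in> Rn n"
  shows "f y + inner (grad n f y) (x - y) + (norm (grad n f x - grad n f y))\<^sup>2 / (4 * L) \<le> f x"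
proof (rule convex_smooth_cocoercive[OF subspace_Rn])
  fix x y assume "x \<in> Rn n" "y \<in> Rn n"
  moreover have "0 \<le> \<mu> / 2 * (norm (y - x))\<^sup>2" using assms by simp
  ultimately show "f x + inner (grad n f x) (y - x) \<le> f y"
    using S1_strongly_convex[OF assms(1), of x y] by linarith
qed (use assms in \<open>simp_all add: grad_in_Rn[OF assms(1)] S1_lipschitz[OF assms(1)]\<close>)

text \<open>A gradient step from \<open>xs\<close> to \<open>w\<close> cannot lower
  \<open>f\<close>, whereas cocoercivity bounds \<open>f w\<close> above. With length
  \<open>1 / (2 * L)\<close> the cross terms cancel, and the sum of the squared gradient norms at
  \<open>xs\<close> and \<open>w\<close> is at most 0.\<close>

lemma grad_minimizer:
  assumes f: "f \<in> S1 n \<mu> L" and L: "0 < \<mu>" "0 < L" and xs: "is_arg_min f (\<lambda>u. u \<in> Rn n) xs"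
  shows "grad n f xs = 0"
proof -
  define v w where "v = grad n f xs" and "w = xs - (1 / (2 * L)) *\<^sub>R v"
  have x: "xs \<in> Rn n" using xs by (simp add: is_arg_min_def)
  have w: "w \<in> Rn n"
    unfolding w_def v_def by (intro subspace_diff subspace_scale subspace_Rn grad_in_Rn[OF f] x)
  have "f xs \<le> f w" using xs w by (auto simp: is_arg_min_linorder)
  moreover have "f w + inner (grad n f w) (xs - w) + (norm (v - grad n f w))\<^sup>2 / (4 * L) \<le> f xs"
    unfolding v_def by (rule S1_cocoercive[OF f L x w])
  moreover have "xs - w = (1 / (2 * L)) *\<^sub>R v" by (simp add: w_def)
  ultimately have "inner (grad n f w) v / (2 * L) + (norm (v - grad n f w))\<^sup>2 / (4 * L) \<le> 0"
    by simp
  then have "2 * inner (grad n f w) v + (norm (v - grad n f w))\<^sup>2 \<le> 0"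
    using L by (simp add: field_simps)
  then have "(norm v)\<^sup>2 + (norm (grad n f w))\<^sup>2 \<le> 0"
    by (simp add: power2_norm_eq_inner inner_diff_left inner_diff_right inner_commute)
  then have "(norm v)\<^sup>2 = 0" by (smt (verit) zero_le_power2)
  then show ?thesis by (simp add: v_def)
qed

section \<open>Elimination of \<open>z\<close> from the algorithm\<close>

lemma algorithm_A_in_Rn:
  assumes A: "algorithm_A n f \<mu> s \<eta> \<nu> \<tau> x y z" and f: "f \<in> S1 n \<mu> L"
  shows "x k \<in> Rn n \<and> z k \<in> Rn n"
proof (induction k)
  case 0
  then show ?case using A by (simp add: algorithm_A_def Let_def)
next
  case (Suc k)
  have y: "y (Suc k) \<in> Rn n"
    using A Suc grad_in_Rn[OF f]
    by (auto simp: algorithm_A_def Let_def intro!: subspace_diff subspace_scale subspace_Rn)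
  have z: "z (Suc k) \<in> Rn n"
    using A Suc grad_in_Rn[OF f]
    by (auto simp: algorithm_A_def Let_def
        intro!: subspace_add subspace_diff subspace_scale subspace_Rn simp del: scaleR_left_diff_distrib)
  have "x (Suc k) = (\<tau> * sqrt (\<mu> * s) / (1 + sqrt (\<mu> * s))) *\<^sub>R z (Suc k)
                          + (1 - \<tau> * sqrt (\<mu> * s) / (1 + sqrt (\<mu> * s))) *\<^sub>R y (Suc k)"
    using A by (simp add: algorithm_A_def Let_def)
  also have "\<dots> \<in> Rn n" by (intro subspace_add subspace_scale subspace_Rn y z)
  finally show ?case using z by simp
qed

text \<open>Eliminating \<open>z\<close> turns the algorithm into a heavy-ball scheme for \<open>x\<close> with velocity \<open>d\<close>.\<close>

lemma algorithm_A_heavy_ball: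
  assumes A: "algorithm_A n f \<mu> s \<eta> \<nu> \<tau> x y z" and pos: "0 < \<mu>" "0 < s"
    and r: "r = sqrt (\<mu> * s)" and t: "t = \<tau> * r / (1 + r)" and \<tau>: "\<tau> * r < 1"
    and \<alpha>: "\<alpha> = 1 - (1 - t) * (1 - \<nu> * r)" and b: "b = \<tau> * (\<nu> - \<eta> * r) / (1 + r)"
  obtains d where "d 0 = - (s * b) *\<^sub>R grad n f (x 0)"
    and "\<And>k. x (Suc k) = x k + d k - (\<eta> * s) *\<^sub>R grad n f (x k)"
    and "\<And>k. d (Suc k) = (1 - \<alpha>) *\<^sub>R d k - (s * b) *\<^sub>R grad n f (x (Suc k))"
proof -
  \<comment> \<open>The velocity is the displacement from \<open>y (Suc k)\<close> to
    \<open>x (Suc k)\<close>, indexed by the point that the step leaves.\<close>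
  define d where "d k = t *\<^sub>R (z (Suc k) - y (Suc k))" for k
  have r0: "0 < r" using pos r by simp
  have r2: "r * r = \<mu> * s" using pos r by simp
  have t1: "t \<noteq> 1" using \<tau> r0 by (simp add: t field_simps)
  have ys: "y (Suc k) = x k - (\<eta> * s) *\<^sub>R grad n f (x k)"
    and zs: "z (Suc k) = (\<nu> * r) *\<^sub>R (x k - (1 / \<mu>) *\<^sub>R grad n f (x k)) + (1 - \<nu> * r) *\<^sub>R z k"
    and xs: "x (Suc k) = t *\<^sub>R z (Suc k) + (1 - t) *\<^sub>R y (Suc k)" for k
    using A by (simp_all add: algorithm_A_def Let_def r t)
  \<comment> \<open>The factors \<open>r\<close> in \<open>t\<close> and in \<open>\<nu> * r\<close>
    combine to \<open>\<mu> * s\<close>, which cancels the division by \<open>\<mu>\<close>.\<close>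
  have coef: "t * (\<nu> * r / \<mu> - \<eta> * s) = s * b"
  proof -
    have "t * (\<nu> * r / \<mu> - \<eta> * s) = \<tau> * (\<nu> * (r * r) / \<mu> - \<eta> * r * s) / (1 + r)"
      by (simp add: t algebra_simps add_divide_distrib diff_divide_distrib)
    also have "\<dots> = s * b" unfolding r2 using pos by (simp add: b algebra_simps)
    finally show ?thesis .
  qed
  have d: "d k = (t * (1 - \<nu> * r)) *\<^sub>R (z k - x k) - (s * b) *\<^sub>R grad n f (x k)" for k
    unfolding coef[symmetric] d_def ys zs
    by (intro fseq_eqI) (simp add: algebra_simps)
  show ?thesis
  proof
    \<comment> \<open>Since \<open>z 0 = x 0\<close>, only the gradient part of the initial velocity
      survives.\<close>
    show "d 0 = - (s * b) *\<^sub>R grad n f (x 0)"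
      using A by (simp add: d algorithm_A_def Let_def)
    show "x (Suc k) = x k + d k - (\<eta> * s) *\<^sub>R grad n f (x k)" for k
      unfolding xs d_def ys by (intro fseq_eqI) (simp add: algebra_simps)
    \<comment> \<open>Averaging shrinks \<open>z - y\<close> to \<open>z - x\<close> by the factor
      \<open>1 - t\<close>; together with \<open>1 - \<nu> * r\<close> this yields the friction
      factor \<open>1 - \<alpha>\<close>.\<close>
    have "t *\<^sub>R (z (Suc k) - x (Suc k)) = (1 - t) *\<^sub>R d k" for k
      unfolding xs d_def by (intro fseq_eqI) (simp add: algebra_simps)
    then have "(t * (1 - \<nu> * r)) *\<^sub>R (z (Suc k) - x (Suc k)) = (1 - \<alpha>) *\<^sub>R d k" for k
      by (metis \<alpha> add_diff_cancel_left' diff_add_cancel mult.commute scaleR_scaleR)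
    then show "d (Suc k) = (1 - \<alpha>) *\<^sub>R d k - (s * b) *\<^sub>R grad n f (x (Suc k))" for k
      unfolding d[of "Suc k"] by simp
  qed
qed

section \<open>Linear rate with explicit constants\<close>

text \<open>All smallness is measured by \<open>\<epsilon>\<close>: as \<open>\<mu> \<le> L\<close>,
  the bound \<open>s * L \<le> \<epsilon>\<^sup>2\<close> also gives
  \<open>sqrt (\<mu> * s) \<le> \<epsilon>\<close>. Then \<open>\<alpha>\<close> lies between
  \<open>\<nu> * r\<close> and \<open>(\<nu> + \<tau>) * r\<close>, and \<open>b\<close> between
  \<open>B / 2\<close> and \<open>B\<close>, so the contraction constants depend only on the
  parameters.\<close>

lemma algorithm_A_rate:
  fixes \<epsilon> :: real
  assumes par: "0 < \<nu>" "0 < \<tau>" "0 \<le> \<eta>"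
    and \<epsilon>: "0 < \<epsilon>" "\<epsilon> \<le> 1 / 2" "\<nu> * \<epsilon> \<le> 1" "\<tau> * \<epsilon> < 1" "4 * \<eta> * \<epsilon> \<le> \<nu>" "4 * \<eta> * \<epsilon> \<le> 1"
      "40 * \<eta>\<^sup>2 * \<epsilon> \<le> \<nu> * \<tau>" "16 * (16 * (\<nu> * \<tau>)\<^sup>2 + 10 * \<eta>\<^sup>2) * \<epsilon> \<le> \<nu> * \<tau>"
      "8 * (\<nu> * \<tau>) * \<epsilon> \<le> 1" "16 * (\<nu> * \<tau>) * \<epsilon> \<le> \<nu>"
    and f: "0 < \<mu>" "\<mu> \<le> L" "f \<in> S1 n \<mu> L" "is_arg_min f (\<lambda>u. u \<in> Rn n) xs"
    and s: "0 < s" "s * L \<le> \<epsilon>\<^sup>2" "\<nu> * \<tau> / 2 \<le> \<eta> \<or> s * L \<le> \<epsilon> * sqrt (\<mu> * s)"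
    and A: "algorithm_A n f \<mu> s \<eta> \<nu> \<tau> x y z"
  shows "f (x k) - f xs
    \<le> (4 + 3 * (\<nu> * \<tau>) + 2 * (\<nu> + \<tau>)\<^sup>2 / (\<nu> * \<tau>)) * L * (norm (x 0 - xs))\<^sup>2
       * (1 - \<nu> / (2 * (12 + 4 * (\<nu> + \<tau>)\<^sup>2 / (\<nu> * \<tau>))) * sqrt (\<mu> * s)) ^ k"
proof -
  define B r t where "B = \<nu> * \<tau>" and "r = sqrt (\<mu> * s)" and "t = \<tau> * r / (1 + r)"
  define \<alpha> b M where "\<alpha> = 1 - (1 - t) * (1 - \<nu> * r)" and "b = \<tau> * (\<nu> - \<eta> * r) / (1 + r)"
    and "M = 12 + 4 * (\<nu> + \<tau>)\<^sup>2 / B"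
  have L: "0 < L" using f by simp
  have B: "0 < B" using par by (simp add: B_def)
  have sL: "0 < s * L" "s * L \<le> \<epsilon>"
  proof -
    have "\<epsilon>\<^sup>2 \<le> \<epsilon> * 1" unfolding power2_eq_square using \<epsilon> by (intro mult_left_mono) auto
    then show "s * L \<le> \<epsilon>" using s by simp
  qed (use s L in simp)
  have "\<mu> * s \<le> s * L" using f s by (simp add: mult.commute)
  then have r: "0 < r" "r \<le> \<epsilon>" "r * r = \<mu> * s"
    using f s \<epsilon> order_trans[OF \<open>\<mu> * s \<le> s * L\<close> s(2)] by (simp_all add: r_def real_le_lsqrt)
  have le: "c * e \<le> c * \<epsilon>" if "0 \<le> c" "e \<le> \<epsilon>" for c e :: real
    using that by (rule mult_left_mono[rotated])
  have \<nu>r: "\<nu> * r \<le> 1" and \<tau>r: "\<tau> * r < 1" and \<eta>r: "4 * \<eta> * r \<le> \<nu>"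
    using le[of \<nu> r] le[of \<tau> r] le[of "4 * \<eta>" r] r par \<epsilon>(3-5) by linarith+
  have t: "0 < t" "t \<le> \<tau> * r" "t \<le> 1"
  proof -
    show "0 < t" using r par by (simp add: t_def)
    have "\<tau> * r / (1 + r) \<le> \<tau> * r / 1" using r par by (intro divide_left_mono) auto
    then show "t \<le> \<tau> * r" by (simp add: t_def)
    then show "t \<le> 1" using \<tau>r by simp
  qed
  have \<alpha>_eq: "\<alpha> = \<nu> * r + t * (1 - \<nu> * r)" by (simp add: \<alpha>_def algebra_simps)
  have \<alpha>: "\<nu> * r \<le> \<alpha>" "\<alpha> \<le> (\<nu> + \<tau>) * r" "\<alpha> \<le> 1" "0 < \<alpha>"
  proof -
    have "0 \<le> t * (1 - \<nu> * r)" using t \<nu>r by simp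
    then show *: "\<nu> * r \<le> \<alpha>" by (simp add: \<alpha>_eq)
    have "t * (1 - \<nu> * r) \<le> t * 1" using t par r by (intro mult_left_mono) auto
    then show "\<alpha> \<le> (\<nu> + \<tau>) * r" using t by (simp add: \<alpha>_eq algebra_simps)
    have "0 \<le> (1 - t) * (1 - \<nu> * r)" using t \<nu>r by simp
    then show "\<alpha> \<le> 1" by (simp add: \<alpha>_def)
    show "0 < \<alpha>" using * mult_pos_pos[of \<nu> r] par r by linarith
  qed
  have \<alpha>2: "\<alpha>\<^sup>2 \<le> (\<nu> + \<tau>)\<^sup>2 * (\<mu> * s)"
  proof -
    have "\<alpha>\<^sup>2 \<le> ((\<nu> + \<tau>) * r)\<^sup>2" using \<alpha> by (intro power_mono) auto
    then show ?thesis using r by (simp add: power_mult_distrib power2_eq_square[of r])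
  qed
  have b: "B / 2 \<le> b" "b \<le> B"
  proof -
    have "\<nu> * r \<le> \<nu> * (1 / 2)" using r \<epsilon>(2) par by (intro mult_left_mono) auto
    then have "\<nu> * (1 + r) \<le> 2 * (\<nu> - \<eta> * r)" using \<eta>r by (simp add: algebra_simps)
    then have "\<tau> * (\<nu> * (1 + r)) \<le> \<tau> * (2 * (\<nu> - \<eta> * r))"
      using par by (intro mult_left_mono) auto
    then show "B / 2 \<le> b" using r by (simp add: b_def B_def field_simps)
    have "\<tau> * (\<nu> - \<eta> * r) \<le> \<tau> * (\<nu> * (1 + r))"
      using par r by (intro mult_left_mono) (auto simp: algebra_simps)
    then show "b \<le> B" using r by (simp add: b_def B_def field_simps)
  qed
  have b0: "0 < b" using b B by linarith
  have small: "4 * \<eta> * (s * L) \<le> 1" "20 * \<eta>\<^sup>2 * (s * L) \<le> b"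
      "8 * (16 * b\<^sup>2 + 10 * \<eta>\<^sup>2) * (s * L) \<le> b" "8 * b * (s * L) \<le> 1"
  proof -
    show "4 * \<eta> * (s * L) \<le> 1" using le[of "4 * \<eta>" "s * L"] sL par \<epsilon> by auto
    show "20 * \<eta>\<^sup>2 * (s * L) \<le> b" using le[of "20 * \<eta>\<^sup>2" "s * L"] sL b \<epsilon> by (auto simp: B_def)
    have "b\<^sup>2 \<le> B\<^sup>2" using b b0 by (intro power_mono) auto
    then have "8 * (16 * b\<^sup>2 + 10 * \<eta>\<^sup>2) * (s * L) \<le> 8 * (16 * B\<^sup>2 + 10 * \<eta>\<^sup>2) * \<epsilon>"
      using sL by (intro mult_mono) auto
    then show "8 * (16 * b\<^sup>2 + 10 * \<eta>\<^sup>2) * (s * L) \<le> b"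
      using b(1) \<epsilon>(8) unfolding B_def[symmetric] by linarith
    have "8 * b * (s * L) \<le> 8 * B * \<epsilon>" using sL b b0 by (intro mult_mono) auto
    then show "8 * b * (s * L) \<le> 1" using \<epsilon> by (simp add: B_def)
  qed
  \<comment> \<open>Either \<open>b \<le> B \<le> 2 * \<eta>\<close>, or \<open>s * L\<close> is
    small relative to \<open>r\<close> while \<open>\<alpha>\<close> is at least
    \<open>\<nu> * r\<close>.\<close>
  have damp: "b \<le> 2 * \<eta> \<or> 16 * b * (s * L) \<le> \<alpha>"
    using s(3)
  proof
    assume "\<nu> * \<tau> / 2 \<le> \<eta>"
    then show ?thesis using b by (auto simp: B_def)
  next
    assume "s * L \<le> \<epsilon> * sqrt (\<mu> * s)"
    then have "16 * b * (s * L) \<le> 16 * B * (\<epsilon> * r)"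
      by - (rule mult_mono, use sL b b0 B in \<open>auto simp: r_def\<close>)
    also have "\<dots> = 16 * (\<nu> * \<tau>) * \<epsilon> * r" by (simp add: B_def)
    also have "\<dots> \<le> \<nu> * r" using \<epsilon> r by (intro mult_right_mono) auto
    finally show ?thesis using \<alpha> by linarith
  qed
  have M12: "12 \<le> M" using B by (simp add: M_def)
  \<comment> \<open>The second summand of \<open>M\<close> is tuned to the bounds
    \<open>\<alpha>2\<close> and \<open>B / 2 \<le> b\<close>.\<close>
  have M\<alpha>: "2 * \<alpha>\<^sup>2 \<le> M * (b * (\<mu> * s))"
  proof -
    have "2 * \<alpha>\<^sup>2 \<le> (4 * (\<nu> + \<tau>)\<^sup>2 / B) * (B / 2) * (\<mu> * s)" using \<alpha>2 B by simp
    also have "\<dots> \<le> M * b * (\<mu> * s)"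
      using f s b B by (intro mult_right_mono mult_mono) (auto simp: M_def)
    finally show ?thesis by simp
  qed
  obtain d where d0: "d 0 = - (s * b) *\<^sub>R grad n f (x 0)"
    and xS: "\<And>k. x (Suc k) = x k + d k - (\<eta> * s) *\<^sub>R grad n f (x k)"
    and dS: "\<And>k. d (Suc k) = (1 - \<alpha>) *\<^sub>R d k - (s * b) *\<^sub>R grad n f (x (Suc k))"
    using algorithm_A_heavy_ball[OF A f(1) s(1) r_def t_def \<tau>r \<alpha>_def b_def] by metis
  have xR: "x k \<in> Rn n" for k using algorithm_A_in_Rn[OF A f(3)] by blast
  have xsR: "xs \<in> Rn n" using f(4) by (simp add: is_arg_min_def)
  have g0: "grad n f xs = 0" by (rule grad_minimizer[OF f(3) f(1) L f(4)])
  define u g F where "u = (\<lambda>k. x k - xs)" and "g = (\<lambda>k. grad n f (x k))" and "F = (\<lambda>k. f (x k) - f xs)"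
  have F0: "0 \<le> F k" for k using f(4) xR[of k] by (auto simp: F_def is_arg_min_linorder)
  have strong: "F k + \<mu> / 2 * (norm (u k))\<^sup>2 \<le> inner (u k) (g k)" for k
    using S1_strongly_convex[OF f(3) xR[of k] xsR]
    by (simp add: F_def u_def g_def inner_diff_left inner_diff_right inner_commute norm_minus_commute)
  have mono: "F k \<le> inner (u k) (g k)" for k
  proof -
    have "0 \<le> \<mu> / 2 * (norm (u k))\<^sup>2" using f by simp
    then show ?thesis using strong[of k] by linarith
  qed
  have grad: "(norm (g k))\<^sup>2 \<le> 4 * L * F k" for k
    using S1_cocoercive[OF f(3) f(1) L xR[of k] xsR] L by (simp add: g0 F_def g_def field_simps)
  have coco: "F (Suc k) \<le> F k + inner (g (Suc k)) (u (Suc k) - u k)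
      - (norm (g (Suc k) - g k))\<^sup>2 / (4 * L)" for k
    using S1_cocoercive[OF f(3) f(1) L xR[of k] xR[of "Suc k"]]
    by (simp add: F_def g_def u_def inner_diff_right norm_minus_commute)
  have gu: "norm (g k) \<le> L * norm (u k)" for k
    using S1_lipschitz[OF f(3) xsR xR[of k]] by (simp add: g0 g_def u_def)
  have uS: "u (Suc k) = u k + d k - (\<eta> * s) *\<^sub>R g k" for k
    by (simp add: u_def g_def xS)
  define V where "V = (\<lambda>k. lyapunov s b \<eta> \<alpha> (F k) (u k) (d k) (g k))"
  define \<rho> where "\<rho> = 1 - \<nu> / (2 * M) * r"
  have V0: "2 * s * b * F k \<le> V k" for k
    unfolding V_def by (rule lyapunov_ge) (use s b0 par grad small F0 in auto)
  have Vn: "0 \<le> V k" for k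
  proof -
    have "0 \<le> 2 * s * b * F k" using s b0 F0 by simp
    then show ?thesis using V0[of k] by linarith
  qed
  have step: "V (Suc k) \<le> \<rho> * V k" for k
  proof -
    have "V (Suc k) \<le> (1 - \<alpha> / (2 * M)) * V k"
      unfolding V_def dS uS g_def[symmetric] unfolding fun_cong[OF g_def, symmetric]
      by (rule lyapunov_contraction)
        (use s b0 par \<alpha> L F0 f M12 M\<alpha> small damp strong[of "Suc k"] grad coco[of k]
            order_trans[OF F0 mono] in \<open>auto simp: uS\<close>)
    also have "\<dots> \<le> \<rho> * V k"
    proof (rule mult_right_mono[OF _ Vn])
      have "\<nu> * r / (2 * M) \<le> \<alpha> / (2 * M)" using \<alpha> M12 by (intro divide_right_mono) auto
      then show "1 - \<alpha> / (2 * M) \<le> \<rho>" by (simp add: \<rho>_def)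
    qed
    finally show ?thesis .
  qed
  \<comment> \<open>The sign of \<open>\<rho>\<close> allows the one-step bound to be iterated and
    \<open>V 0\<close> to be replaced by its upper bound.\<close>
  have \<rho>0: "0 \<le> \<rho>"
  proof -
    have "\<nu> * r / (2 * M) \<le> 1 / 1" using \<nu>r M12 par r by (intro frac_le) auto
    then show ?thesis by (simp add: \<rho>_def)
  qed
  have Vk: "V k \<le> V 0 * \<rho> ^ k" for k
  proof (induction k)
    case (Suc k)
    have "V (Suc k) \<le> \<rho> * V k" by (rule step)
    also have "\<dots> \<le> \<rho> * (V 0 * \<rho> ^ k)" using Suc \<rho>0 by (rule mult_left_mono)
    finally show ?case by (simp add: mult_ac)
  qed simp
  let ?U = "(norm (u 0))\<^sup>2"
  \<comment> \<open>Every term is of order \<open>s * L * ?U\<close>. The squared initial velocity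
    even carries \<open>(s * L)\<^sup>2\<close>, and one of these factors is bounded by 1.\<close>
  have init: "V 0 \<le> s * L * ?U * (4 * B + 3 * B\<^sup>2 + 2 * (\<nu> + \<tau>)\<^sup>2)"
  proof -
    have "V 0 \<le> 4 * s * b * F 0 + 3 * (norm (d 0))\<^sup>2 + 2 * \<alpha>\<^sup>2 * ?U"
      unfolding V_def by (rule lyapunov_le) (use s b0 par in auto)
    moreover have "4 * s * b * F 0 \<le> 4 * s * B * (L * ?U)"
    proof (rule mult_mono)
      have "F 0 \<le> inner (u 0) (g 0)" by (rule mono)
      also have "\<dots> \<le> norm (u 0) * norm (g 0)" by (rule norm_cauchy_schwarz)
      also have "\<dots> \<le> norm (u 0) * (L * norm (u 0))" using gu by (rule mult_left_mono) simp
      finally show "F 0 \<le> L * ?U" by (simp add: power2_eq_square mult_ac)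
    qed (use s b b0 B F0 in auto)
    moreover have "(norm (d 0))\<^sup>2 \<le> B\<^sup>2 * (s * L * ?U)"
    proof -
      have "(norm (d 0))\<^sup>2 = (s * b)\<^sup>2 * (norm (g 0))\<^sup>2"
        by (simp add: d0 g_def power_mult_distrib)
      also have "\<dots> \<le> (s * B)\<^sup>2 * (L * norm (u 0))\<^sup>2"
        using s b b0 B gu[of 0] by (intro mult_mono power_mono) auto
      also have "\<dots> = s * L * (B\<^sup>2 * (s * L * ?U))" by (simp add: power2_eq_square)
      also have "\<dots> \<le> 1 * (B\<^sup>2 * (s * L * ?U))" using sL \<epsilon> by (intro mult_right_mono) auto
      finally show ?thesis by simp
    qed
    moreover have "2 * \<alpha>\<^sup>2 * ?U \<le> 2 * ((\<nu> + \<tau>)\<^sup>2 * (s * L)) * ?U"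
    proof -
      have "(\<nu> + \<tau>)\<^sup>2 * (\<mu> * s) \<le> (\<nu> + \<tau>)\<^sup>2 * (s * L)"
        using \<open>\<mu> * s \<le> s * L\<close> by (rule mult_left_mono) simp
      then show ?thesis using \<alpha>2 by (intro mult_right_mono) auto
    qed
    ultimately show ?thesis by (simp add: algebra_simps)
  qed
  \<comment> \<open>Both the lower bound \<open>V0\<close> and the upper bound \<open>init\<close>
    are proportional to \<open>s\<close>, so dividing by \<open>s * B\<close> leaves a constant
    times \<open>L * ?U\<close>.\<close>
  have "s * B * F k \<le> 2 * s * b * F k" using s b F0[of k] mult_right_mono[of B "2 * b" "s * F k"] by (simp add: mult_ac)
  also have "\<dots> \<le> V 0 * \<rho> ^ k" using V0 Vk order_trans by blast
  also have "\<dots> \<le> s * L * ?U * (4 * B + 3 * B\<^sup>2 + 2 * (\<nu> + \<tau>)\<^sup>2) * \<rho> ^ k"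
    using init \<rho>0 by (intro mult_right_mono) auto
  also have "\<dots> = s * B * ((4 + 3 * B + 2 * (\<nu> + \<tau>)\<^sup>2 / B) * L * ?U * \<rho> ^ k)"
    using B by (simp add: field_simps power2_eq_square)
  finally have "F k \<le> (4 + 3 * B + 2 * (\<nu> + \<tau>)\<^sup>2 / B) * L * ?U * \<rho> ^ k"
    using s B by simp
  then show ?thesis by (simp add: F_def u_def \<rho>_def M_def B_def r_def)
qed

section \<open>Choice of the constants\<close>

lemma eventually_linear_small:
  fixes c e :: real
  assumes "0 < e"
  shows "\<forall>\<^sub>F \<epsilon> in at_right 0. c * \<epsilon> < e"
proof -
  have "((\<lambda>\<epsilon>. c * \<epsilon>) \<longlongrightarrow> c * 0) (at_right 0)" by (intro tendsto_intros)
  then show ?thesis using assms by (auto dest: order_tendstoD(2))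
qed

text \<open>The conditions on \<open>\<epsilon>\<close> are finitely many bounds of the form
  \<open>c * \<epsilon> < e\<close> with \<open>e\<close> positive, so some positive
  \<open>\<epsilon>\<close> meets them all; \<open>C0\<close> is then
  \<open>\<epsilon>\<^sup>2\<close> in both stepsize regimes.\<close>

lemma algorithm_A_converges:
  fixes \<eta> \<nu> \<tau> :: real
  assumes par: "0 < \<nu>" "0 < \<tau>" "0 \<le> \<eta>"
  shows "\<exists>C>0. \<exists>C0>0. \<exists>C1>0. \<forall>n \<mu> L f xstar s x y z.
      0 < \<mu> \<and> \<mu> \<le> L \<and> f \<in> S1 n \<mu> L \<and> is_arg_min f (\<lambda>u. u \<in> Rn n) xstar \<and> 0 < s
      \<and> (s \<le> C0 * \<mu> / L\<^sup>2 \<or> \<nu> * \<tau> / 2 \<le> \<eta> \<and> s \<le> C0 / L) \<and> algorithm_A n f \<mu> s \<eta> \<nu> \<tau> x y z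
      \<longrightarrow> (\<forall>k. f (x k) - f xstar \<le> C * L * (norm (x 0 - xstar))\<^sup>2 * (1 - C1 * sqrt (\<mu> * s)) ^ k)"
proof -
  have B: "0 < \<nu> * \<tau>" using par by simp
  have "\<forall>\<^sub>F \<epsilon> in at_right 0. 0 < \<epsilon> \<and> 1 * \<epsilon> < 1 / 2 \<and> \<nu> * \<epsilon> < 1 \<and> \<tau> * \<epsilon> < 1 \<and> 4 * \<eta> * \<epsilon> < \<nu> \<and> 4 * \<eta> * \<epsilon> < 1
     \<and> 40 * \<eta>\<^sup>2 * \<epsilon> < \<nu> * \<tau> \<and> 16 * (16 * (\<nu> * \<tau>)\<^sup>2 + 10 * \<eta>\<^sup>2) * \<epsilon> < \<nu> * \<tau>
     \<and> 8 * (\<nu> * \<tau>) * \<epsilon> < 1 \<and> 16 * (\<nu> * \<tau>) * \<epsilon> < \<nu>"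
    by (intro eventually_conj eventually_linear_small eventually_at_right_less B par) auto
  then obtain \<epsilon> where \<epsilon>: "0 < \<epsilon>" "1 * \<epsilon> < 1 / 2" "\<nu> * \<epsilon> < 1" "\<tau> * \<epsilon> < 1" "4 * \<eta> * \<epsilon> < \<nu>" "4 * \<eta> * \<epsilon> < 1"
      "40 * \<eta>\<^sup>2 * \<epsilon> < \<nu> * \<tau>" "16 * (16 * (\<nu> * \<tau>)\<^sup>2 + 10 * \<eta>\<^sup>2) * \<epsilon> < \<nu> * \<tau>"
      "8 * (\<nu> * \<tau>) * \<epsilon> < 1" "16 * (\<nu> * \<tau>) * \<epsilon> < \<nu>"
    using eventually_happens'[OF trivial_limit_at_right_real] by blast
  show ?thesis
  proof (intro exI conjI allI impI; (elim conjE)?)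
    show "0 < 4 + 3 * (\<nu> * \<tau>) + 2 * (\<nu> + \<tau>)\<^sup>2 / (\<nu> * \<tau>)" using par B by (intro add_pos_nonneg) auto
    show "0 < \<epsilon>\<^sup>2" using \<epsilon> by simp
    show "0 < \<nu> / (2 * (12 + 4 * (\<nu> + \<tau>)\<^sup>2 / (\<nu> * \<tau>)))"
      using par B by (intro divide_pos_pos mult_pos_pos add_pos_nonneg) auto
  next
    fix n \<mu> L f xstar s x y z and k :: nat
    assume f: "0 < \<mu>" "\<mu> \<le> L" "f \<in> S1 n \<mu> L" "is_arg_min f (\<lambda>u. u \<in> Rn n) xstar"
      and s: "0 < s" "s \<le> \<epsilon>\<^sup>2 * \<mu> / L\<^sup>2 \<or> \<nu> * \<tau> / 2 \<le> \<eta> \<and> s \<le> \<epsilon>\<^sup>2 / L"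
      and A: "algorithm_A n f \<mu> s \<eta> \<nu> \<tau> x y z"
    have L: "0 < L" using f by simp
    have "s * L \<le> \<epsilon>\<^sup>2 \<and> (\<nu> * \<tau> / 2 \<le> \<eta> \<or> s * L \<le> \<epsilon> * sqrt (\<mu> * s))"
      using s(2)
    proof
      \<comment> \<open>With \<open>\<mu> \<le> L\<close> this gives
        \<open>s * L \<le> \<epsilon>\<^sup>2\<close>; multiplied by \<open>s\<close> it gives the
        square of the bound relating \<open>s * L\<close> to
        \<open>sqrt (\<mu> * s)\<close>.\<close>
      assume "s \<le> \<epsilon>\<^sup>2 * \<mu> / L\<^sup>2"
      then have sL: "s * L * L \<le> \<epsilon>\<^sup>2 * \<mu>" using L by (simp add: field_simps power2_eq_square)
      also have "\<dots> \<le> \<epsilon>\<^sup>2 * L" using f by (intro mult_left_mono) auto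
      finally have "s * L \<le> \<epsilon>\<^sup>2" using L by simp
      moreover have "(s * L)\<^sup>2 \<le> \<epsilon>\<^sup>2 * (\<mu> * s)"
        using mult_left_mono[OF sL, of s] s by (simp add: power2_eq_square mult_ac)
      then have "(s * L)\<^sup>2 \<le> (\<epsilon> * sqrt (\<mu> * s))\<^sup>2"
        using f s by (simp add: power_mult_distrib)
      then have "s * L \<le> \<epsilon> * sqrt (\<mu> * s)"
        by (rule power2_le_imp_le) (use \<epsilon> f s in auto)
      ultimately show ?thesis by simp
    next
      assume "\<nu> * \<tau> / 2 \<le> \<eta> \<and> s \<le> \<epsilon>\<^sup>2 / L"
      then show ?thesis using L by (simp add: field_simps)
    qed
    then show "f (x k) - f xstar
       \<le> (4 + 3 * (\<nu> * \<tau>) + 2 * (\<nu> + \<tau>)\<^sup>2 / (\<nu> * \<tau>)) * L * (norm (x 0 - xstar))\<^sup>2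
         * (1 - \<nu> / (2 * (12 + 4 * (\<nu> + \<tau>)\<^sup>2 / (\<nu> * \<tau>))) * sqrt (\<mu> * s)) ^ k"
      using algorithm_A_rate[OF par _ _ _ _ _ _ _ _ _ _ f s(1) _ _ A, of \<epsilon>] \<epsilon> by simp
  qed
qed

theorem theorem1:
  fixes \<eta>0 \<nu>0 \<tau>0 :: real
  assumes "0 \<le> \<eta>0" and "0 \<le> \<nu>0" and "0 \<le> \<tau>0"
  shows
    "((0 < \<nu>0 \<and> 0 < \<tau>0 \<and> \<nu>0 \<noteq> \<tau>0 \<and> 0 \<le> \<eta>0 \<and> \<eta>0 < \<nu>0 * \<tau>0 / 2)
      \<or> (\<nu>0 = \<tau>0 \<and> 2 < \<tau>0 \<and> \<eta>0 = \<tau>0\<^sup>2 / 2)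
      \<longrightarrow> (\<exists>C>0. \<exists>C0>0. \<exists>C1>0. \<forall>n \<mu> L f xstar s x y z.
            0 < \<mu> \<and> \<mu> \<le> L \<and> f \<in> S1 n \<mu> L
            \<and> is_arg_min f (\<lambda>u. u \<in> Rn n) xstar
            \<and> 0 < s \<and> s \<le> C0 * \<mu> / L\<^sup>2
            \<and> algorithm_A n f \<mu> s \<eta>0 \<nu>0 \<tau>0 x y z
            \<longrightarrow> (\<forall>k\<ge>1. f (x k) - f xstar
                  \<le> C * L * (norm (x 0 - xstar))\<^sup>2 * (1 - C1 * sqrt (\<mu> * s)) ^ k)))
     \<and>
     ((0 < \<nu>0 \<and> 0 < \<tau>0 \<and> \<nu>0 \<noteq> \<tau>0 \<and> \<nu>0 * \<tau>0 / 2 \<le> \<eta>0)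
      \<or> (\<nu>0 = \<tau>0 \<and> 2 \<le> \<tau>0 \<and> \<tau>0\<^sup>2 / 2 < \<eta>0)
      \<or> (\<nu>0 = \<tau>0 \<and> 1 < \<tau>0 \<and> \<tau>0 < 2 \<and> \<tau>0 < \<eta>0)
      \<or> (\<nu>0 = \<tau>0 \<and> 0 < \<tau>0 \<and> \<tau>0 \<le> 1 \<and> \<tau>0 \<le> \<eta>0)
      \<longrightarrow> (\<exists>C>0. \<exists>C0>0. \<exists>C1>0. \<forall>n \<mu> L f xstar s x y z.
            0 < \<mu> \<and> \<mu> \<le> L \<and> f \<in> S1 n \<mu> L
            \<and> is_arg_min f (\<lambda>u. u \<in> Rn n) xstar
            \<and> 0 < s \<and> s \<le> C0 / L
            \<and> algorithm_A n f \<mu> s \<eta>0 \<nu>0 \<tau>0 x y z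
            \<longrightarrow> (\<forall>k\<ge>1. f (x k) - f xstar
                  \<le> C * L * (norm (x 0 - xstar))\<^sup>2 * (1 - C1 * sqrt (\<mu> * s)) ^ k)))"
proof (intro conjI impI)
  assume "(0 < \<nu>0 \<and> 0 < \<tau>0 \<and> \<nu>0 \<noteq> \<tau>0 \<and> 0 \<le> \<eta>0 \<and> \<eta>0 < \<nu>0 * \<tau>0 / 2)
      \<or> (\<nu>0 = \<tau>0 \<and> 2 < \<tau>0 \<and> \<eta>0 = \<tau>0\<^sup>2 / 2)"
  then have "0 < \<nu>0" "0 < \<tau>0" by auto
  then show "\<exists>C>0. \<exists>C0>0. \<exists>C1>0. \<forall>n \<mu> L f xstar s x y z.
            0 < \<mu> \<and> \<mu> \<le> L \<and> f \<in> S1 n \<mu> L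
            \<and> is_arg_min f (\<lambda>u. u \<in> Rn n) xstar
            \<and> 0 < s \<and> s \<le> C0 * \<mu> / L\<^sup>2
            \<and> algorithm_A n f \<mu> s \<eta>0 \<nu>0 \<tau>0 x y z
            \<longrightarrow> (\<forall>k\<ge>1. f (x k) - f xstar
                  \<le> C * L * (norm (x 0 - xstar))\<^sup>2 * (1 - C1 * sqrt (\<mu> * s)) ^ k)"
    by - (drule (1) algorithm_A_converges[OF _ _ assms(1)], elim ex_forward conj_forward all_forward, auto)
next
  assume H: "(0 < \<nu>0 \<and> 0 < \<tau>0 \<and> \<nu>0 \<noteq> \<tau>0 \<and> \<nu>0 * \<tau>0 / 2 \<le> \<eta>0)
      \<or> (\<nu>0 = \<tau>0 \<and> 2 \<le> \<tau>0 \<and> \<tau>0\<^sup>2 / 2 < \<eta>0)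
      \<or> (\<nu>0 = \<tau>0 \<and> 1 < \<tau>0 \<and> \<tau>0 < 2 \<and> \<tau>0 < \<eta>0)
      \<or> (\<nu>0 = \<tau>0 \<and> 0 < \<tau>0 \<and> \<tau>0 \<le> 1 \<and> \<tau>0 \<le> \<eta>0)"
  then have pos: "0 < \<nu>0" "0 < \<tau>0" by auto
  \<comment> \<open>For equal parameters below 2, half of the square of \<open>\<tau>0\<close> is at
    most \<open>\<tau>0\<close>, hence at most \<open>\<eta>0\<close>. So all four cases lie in the
    regime that admits stepsizes of order 1/L.\<close>
  have \<eta>: "\<nu>0 * \<tau>0 / 2 \<le> \<eta>0"
  proof (cases "\<nu>0 = \<tau>0 \<and> \<tau>0 < 2")
    case True
    then have "\<tau>0 * \<tau>0 \<le> \<tau>0 * 2" using pos by (intro mult_left_mono) auto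
    moreover have "\<tau>0 \<le> \<eta>0" using H True by linarith
    ultimately show ?thesis using True by simp
  qed (use H in \<open>auto simp: power2_eq_square\<close>)
  from pos assms(1) show "\<exists>C>0. \<exists>C0>0. \<exists>C1>0. \<forall>n \<mu> L f xstar s x y z.
            0 < \<mu> \<and> \<mu> \<le> L \<and> f \<in> S1 n \<mu> L
            \<and> is_arg_min f (\<lambda>u. u \<in> Rn n) xstar
            \<and> 0 < s \<and> s \<le> C0 / L
            \<and> algorithm_A n f \<mu> s \<eta>0 \<nu>0 \<tau>0 x y z
            \<longrightarrow> (\<forall>k\<ge>1. f (x k) - f xstar
                  \<le> C * L * (norm (x 0 - xstar))\<^sup>2 * (1 - C1 * sqrt (\<mu> * s)) ^ k)"
    by - (drule (2) algorithm_A_converges, elim ex_forward conj_forward all_forward, use \<eta> in auto)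
qed

end
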